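(* Let $\Delta$ be an interval simplicial complex on $[n]$. Then $\mathrm{Ind}(\Delta)$ is vertex decomposable.
   Context: Let $\Delta$ be a simplicial complex on vertex set $[n]$ (not necessarily pure). $\Delta$ is an interval simplicial complex if for any facet $F=\{i_1<\cdots<i_d\}$ of $\Delta$ (with $d=|F|$ depending on $F$) the interval $[i_1,i_d]=\{i_1,i_1+1,\dots,i_d\}$ is a clique of $\Delta$, in the sense that all $d$-subsets of $[i_1,i_d]$ are facets of $\Delta$. $\mathrm{Ind}(\Delta)$ is the simplicial complex of all subsets of $[n]$ containing no facet of $\Delta$. Vertex decomposability (in the non-pure sense) is defined recursively: a simplicial complex $\Gamma$ is vertex decomposable if either $\Gamma$ is a simplex (possibly $\{\emptyset\}$), or there is a vertex $v$ of $\Gamma$ such that the deletion $\mathrm{Del}_\Gamma(v)=\{F\in\Gamma:v\notin F\}$ and the link $\mathrm{Lk}_\Gamma(v)=\{F\in\Gamma:v\notin F,\ F\cup\{v\}\in\Gamma\}$ are both vertex decomposable and every facet of $\mathrm{Del}_\Gamma(v)$ is a facet of $\Gamma$. *)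

theory Defs
  imports Main
begin

text \<open>The void complex \<open>{}\<close> and unused elements of \<open>V\<close> are allowed; so
  \<open>v\<close> is a vertex of \<open>\<Gamma>\<close> only if \<open>{v} \<in> \<Gamma>\<close>.\<close>

definition simplicial_complex_on :: "'a set \<Rightarrow> 'a set set \<Rightarrow> bool" where
  "simplicial_complex_on V \<Gamma> \<longleftrightarrow>
     finite V \<and> \<Gamma> \<subseteq> Pow V \<and> (\<forall>F\<in>\<Gamma>. \<forall>G. G \<subseteq> F \<longrightarrow> G \<in> \<Gamma>)"

definition facets :: "'a set set \<Rightarrow> 'a set set" where
  "facets \<Gamma> = {F \<in> \<Gamma>. \<forall>G\<in>\<Gamma>. F \<subseteq> G \<longrightarrow> G = F}"

text \<open>A facet is written \<open>{i\<^sub>1 < \<dots> < i\<^sub>d}\<close> with \<open>i\<^sub>1 = Min F\<close> and \<open>i\<^sub>d = Max F\<close>, so it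
  has to be nonempty. This excludes only the complex \<open>{{}}\<close> (every other complex has
  nonempty facets), whose independence complex would be the void complex, which is not
  a simplex.\<close>

definition interval_complex :: "nat \<Rightarrow> nat set set \<Rightarrow> bool" where
  "interval_complex n \<Delta> \<longleftrightarrow>
     simplicial_complex_on {1..n} \<Delta> \<and>
     (\<forall>F\<in>facets \<Delta>. F \<noteq> {} \<and>
        (\<forall>G. G \<subseteq> {Min F..Max F} \<and> card G = card F \<longrightarrow> G \<in> facets \<Delta>))"

definition Ind :: "nat \<Rightarrow> nat set set \<Rightarrow> nat set set" where
  "Ind n \<Delta> = {A. A \<subseteq> {1..n} \<and> \<not> (\<exists>F\<in>facets \<Delta>. F \<subseteq> A)}"

definition deletion :: "'a set set \<Rightarrow> 'a \<Rightarrow> 'a set set" where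
  "deletion \<Gamma> v = {F \<in> \<Gamma>. v \<notin> F}"

definition link :: "'a set set \<Rightarrow> 'a \<Rightarrow> 'a set set" where
  "link \<Gamma> v = {F \<in> \<Gamma>. v \<notin> F \<and> F \<union> {v} \<in> \<Gamma>}"

text \<open>\<open>Pow {} = {{}}\<close> is a simplex; the void complex is not vertex decomposable.\<close>

inductive vertex_decomposable :: "'a set set \<Rightarrow> bool" where
  simplex: "finite V \<Longrightarrow> vertex_decomposable (Pow V)"
| shedding: "simplicial_complex_on V \<Gamma> \<Longrightarrow> {v} \<in> \<Gamma> \<Longrightarrow>
    vertex_decomposable (deletion \<Gamma> v) \<Longrightarrow> vertex_decomposable (link \<Gamma> v) \<Longrightarrow>
    facets (deletion \<Gamma> v) \<subseteq> facets \<Gamma> \<Longrightarrow> vertex_decomposable \<Gamma>"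

end

theory Submission
  imports Defs
begin

text \<open>\<open>Ind n \<Delta>\<close> consists of the sets \<open>A\<close> with \<open>card (A \<inter> {a..b}) \<le> k\<close>, where
  \<open>{a..b}\<close> spans a facet with \<open>k + 1\<close> elements. Complexes cut out by such interval bounds
  are closed under deletion and link. If some bound can be violated, take a violable one with
  \<open>b\<close> minimal and let \<open>v\<close> be the largest vertex in \<open>{a..b}\<close>. A face \<open>A\<close> that extends by \<open>v\<close>
  leaves a second vertex \<open>w < v\<close> of \<open>{a..b}\<close> uncovered, and \<open>A\<close> extends by \<open>w\<close> as well: a
  bound on an interval that contains \<open>w\<close> but not \<open>v\<close> ends before \<open>b\<close>, hence cannot be
  violated. So \<open>v\<close> is a shedding vertex.\<close>

text \<open>The ground set and the bounds vary independently, and an interval may contain points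
  outside \<open>V\<close>: deletion then only shrinks \<open>V\<close>, and a link may also lower
  bounds.\<close>

definition interval_bounded :: "nat set \<Rightarrow> (nat \<times> nat \<times> nat) set \<Rightarrow> nat set set" where
  "interval_bounded V C = {A. A \<subseteq> V \<and> (\<forall>(a, b, k)\<in>C. card (A \<inter> {a..b}) \<le> k)}"

lemma interval_boundedI:
  assumes "A \<subseteq> V" "\<And>a b k. (a, b, k) \<in> C \<Longrightarrow> card (A \<inter> {a..b}) \<le> k"
  shows "A \<in> interval_bounded V C"
  using assms by (auto simp: interval_bounded_def)

lemma interval_boundedD:
  assumes "A \<in> interval_bounded V C"
  shows "A \<subseteq> V" "(a, b, k) \<in> C \<Longrightarrow> card (A \<inter> {a..b}) \<le> k"
  using assms by (auto simp: interval_bounded_def)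

lemma interval_bounded_subset:
  assumes "A \<in> interval_bounded V C" "B \<subseteq> A"
  shows "B \<in> interval_bounded V C"
proof (rule interval_boundedI)
  show "B \<subseteq> V"
    using assms interval_boundedD(1) by blast
  fix a b k assume "(a, b, k) \<in> C"
  then have "card (A \<inter> {a..b}) \<le> k"
    using interval_boundedD(2)[OF assms(1)] by simp
  moreover have "card (B \<inter> {a..b}) \<le> card (A \<inter> {a..b})"
    using assms(2) by (intro card_mono) auto
  ultimately show "card (B \<inter> {a..b}) \<le> k" by simp
qed

lemma simplicial_complex_on_interval_bounded:
  assumes "finite V"
  shows "simplicial_complex_on V (interval_bounded V C)"
  using assms unfolding simplicial_complex_on_def
  by (meson PowI interval_boundedD(1) interval_bounded_subset subsetI)

lemma deletion_interval_bounded: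
  "deletion (interval_bounded V C) v = interval_bounded (V - {v}) C"
  by (auto simp: deletion_def interval_bounded_def)

text \<open>A point of \<open>V\<close> lies in no face when some interval around it has bound 0.
  Such a point cannot be shed, but the induction may discard it from the ground set.\<close>

lemma interval_bounded_remove_nonvertex:
  assumes "{v} \<notin> interval_bounded V C"
  shows "interval_bounded (V - {v}) C = interval_bounded V C"
proof -
  have "v \<notin> A" if "A \<in> interval_bounded V C" for A
    using assms interval_bounded_subset[OF that, of "{v}"] by blast
  then show ?thesis
    unfolding deletion_interval_bounded[symmetric] deletion_def by blast
qed

lemma card_insert_Int_interval:
  fixes v a b :: nat
  assumes "v \<notin> A"
  shows "card (insert v A \<inter> {a..b}) = card (A \<inter> {a..b}) + (if v \<in> {a..b} then 1 else 0)"
  using assms by (simp add: Int_insert_left)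

lemma link_interval_bounded:
  assumes "{v} \<in> interval_bounded V C"
  shows "link (interval_bounded V C) v = interval_bounded (V - {v})
    ((\<lambda>(a, b, k). (a, b, if v \<in> {a..b} then k - 1 else k)) ` C)" (is "?L = interval_bounded _ ?C")
proof (intro set_eqI iffI)
  fix A assume "A \<in> ?L"
  then have A: "v \<notin> A" "insert v A \<in> interval_bounded V C"
    by (auto simp: link_def)
  show "A \<in> interval_bounded (V - {v}) ?C"
  proof (rule interval_boundedI)
    show "A \<subseteq> V - {v}"
      using A interval_boundedD(1) by blast
    fix a b k assume "(a, b, k) \<in> ?C"
    then obtain l where l: "(a, b, l) \<in> C" "k = (if v \<in> {a..b} then l - 1 else l)"
      by auto
    show "card (A \<inter> {a..b}) \<le> k"
      using interval_boundedD(2)[OF A(2) l(1)] l(2) A(1)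
      by (auto simp: card_insert_Int_interval split: if_splits)
  qed
next
  fix A assume A: "A \<in> interval_bounded (V - {v}) ?C"
  have v: "v \<notin> A" "v \<in> V"
    using interval_boundedD(1)[OF A] interval_boundedD(1)[OF assms] by auto
  have "insert v A \<in> interval_bounded V C"
  proof (rule interval_boundedI)
    show "insert v A \<subseteq> V"
      using v interval_boundedD(1)[OF A] by auto
    fix a b k assume k: "(a, b, k) \<in> C"
    then have "(a, b, if v \<in> {a..b} then k - 1 else k) \<in> ?C"
      by force
    \<comment> \<open>As \<open>{v}\<close> is a face, \<open>k\<close> is positive whenever
      \<open>v\<close> lies in \<open>{a..b}\<close>, so \<open>k - 1\<close> is not
      truncated.\<close>
    from interval_boundedD(2)[OF A this] interval_boundedD(2)[OF assms k]
    show "card (insert v A \<inter> {a..b}) \<le> k"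
      by (auto simp: card_insert_Int_interval[OF v(1)] split: if_splits)
  qed
  then show "A \<in> ?L"
    using v(1) interval_bounded_subset[of "insert v A" V C A] by (auto simp: link_def)
qed

text \<open>A facet of the deletion can be enlarged in \<Gamma> only to faces containing
  \<open>v\<close>. Exchanging \<open>v\<close> for \<open>w\<close> would then enlarge it inside
  the deletion as well, against maximality.\<close>

lemma facets_deletion_subset_facets:
  assumes "simplicial_complex_on V \<Gamma>"
    and "\<And>A. insert v A \<in> \<Gamma> \<Longrightarrow> v \<notin> A \<Longrightarrow> \<exists>w. w \<noteq> v \<and> w \<notin> A \<and> insert w A \<in> \<Gamma>"
  shows "facets (deletion \<Gamma> v) \<subseteq> facets \<Gamma>"
proof
  fix F assume "F \<in> facets (deletion \<Gamma> v)"
  then have F: "F \<in> \<Gamma>" "v \<notin> F"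
    and max: "\<And>G. G \<in> \<Gamma> \<Longrightarrow> v \<notin> G \<Longrightarrow> F \<subseteq> G \<Longrightarrow> G = F"
    by (auto simp: facets_def deletion_def)
  have "G = F" if G: "G \<in> \<Gamma>" "F \<subseteq> G" for G
  proof (cases "v \<in> G")
    case True
    then have "insert v F \<in> \<Gamma>"
      using G assms(1) unfolding simplicial_complex_on_def by (meson insert_subset)
    then obtain w where "w \<noteq> v" "w \<notin> F" "insert w F \<in> \<Gamma>"
      using assms(2) F(2) by blast
    with max[of "insert w F"] F(2) show ?thesis by auto
  qed (use max G in auto)
  with F(1) show "F \<in> facets \<Gamma>"
    by (auto simp: facets_def)
qed

lemma interval_bounded_shedding:
  assumes "finite V" and C: "(a, b, k) \<in> C" "k < card (V \<inter> {a..b})"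
    and min: "\<And>a' b' k'. (a', b', k') \<in> C \<Longrightarrow> k' < card (V \<inter> {a'..b'}) \<Longrightarrow> b \<le> b'"
  defines "v \<equiv> Max (V \<inter> {a..b})"
  shows "facets (deletion (interval_bounded V C) v) \<subseteq> facets (interval_bounded V C)"
proof (rule facets_deletion_subset_facets[OF simplicial_complex_on_interval_bounded[OF assms(1)]])
  have "V \<inter> {a..b} \<noteq> {}"
    using C(2) by auto
  then have v: "v \<in> V \<inter> {a..b}"
    unfolding v_def by (intro Max_in) auto
  fix A assume vA: "insert v A \<in> interval_bounded V C" "v \<notin> A"
  have AV: "A \<subseteq> V"
    using interval_boundedD(1)[OF vA(1)] by auto
  \<comment> \<open>\<open>insert v A\<close> obeys the bound \<open>k\<close> while
    \<open>V\<close> exceeds it on \<open>{a..b}\<close>, so \<open>insert v A\<close> misses some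
    point \<open>w\<close> of \<open>V\<close> there.\<close>
  have "card (insert v A \<inter> {a..b}) < card (V \<inter> {a..b})"
    using interval_boundedD(2)[OF vA(1) C(1)] C(2) by simp
  then obtain w where w: "w \<in> V \<inter> {a..b}" "w \<noteq> v" "w \<notin> A"
    using card_mono[of "insert v A \<inter> {a..b}" "V \<inter> {a..b}"] by fastforce
  then have wv: "w < v"
    unfolding v_def by (metis Max_ge finite_Int finite_atLeastAtMost le_neq_implies_less)
  have "insert w A \<in> interval_bounded V C"
  proof (rule interval_boundedI)
    show "insert w A \<subseteq> V"
      using w AV by auto
    fix a' b' k' assume C': "(a', b', k') \<in> C"
    show "card (insert w A \<inter> {a'..b'}) \<le> k'"
    proof (cases "k' < card (V \<inter> {a'..b'})")
      case True
      then have "b \<le> b'"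
        by (rule min[OF C'])
      \<comment> \<open>Here \<open>a' \<le> w < v \<le> b \<le> b'\<close> once \<open>w\<close>
        lies in the interval, so adding \<open>w\<close> costs no more than adding \<open>v\<close>
        did.\<close>
      then have "w \<in> {a'..b'} \<Longrightarrow> v \<in> {a'..b'}"
        using v wv by auto
      then show ?thesis
        using interval_boundedD(2)[OF vA(1) C']
        by (auto simp: card_insert_Int_interval[OF w(3)] card_insert_Int_interval[OF vA(2)]
            split: if_splits)
    next
      case False
      moreover have "card (insert w A \<inter> {a'..b'}) \<le> card (V \<inter> {a'..b'})"
        using w AV by (intro card_mono) auto
      ultimately show ?thesis by simp
    qed
  qed
  with w show "\<exists>w. w \<noteq> v \<and> w \<notin> A \<and> insert w A \<in> interval_bounded V C"
    by blast
qed

text \<open>Induction on \<open>card V\<close> with \<open>C\<close> arbitrary, since passing to a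
  link changes the bounds.\<close>

lemma vertex_decomposable_interval_bounded:
  assumes "finite V"
  shows "vertex_decomposable (interval_bounded V C)"
  using assms
proof (induction "card V" arbitrary: V C rule: less_induct)
  case less
  have IH: "vertex_decomposable (interval_bounded (V - {v}) C')" if "v \<in> V" for v C'
    using less.prems that by (intro less.hyps card_Diff1_less) auto
  let ?violable = "\<lambda>b. \<exists>a k. (a, b, k) \<in> C \<and> k < card (V \<inter> {a..b})"
  show ?case
  proof (cases "\<exists>b. ?violable b")
    case False
    \<comment> \<open>No bound excludes \<open>V\<close> itself, so the complex is a full simplex.
      The case \<open>V = {}\<close>, where the induction ends, falls here.\<close>
    have "V \<in> interval_bounded V C"
      using False by (intro interval_boundedI) (auto simp: not_less)
    then have "interval_bounded V C = Pow V"
      using interval_bounded_subset interval_boundedD(1) by blast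
    then show ?thesis
      using vertex_decomposable.simplex[OF less.prems] by simp
  next
    case True
    define b where "b = (LEAST b. ?violable b)"
    have "?violable b"
      using True unfolding b_def by (rule LeastI_ex)
    then obtain a k where C: "(a, b, k) \<in> C" "k < card (V \<inter> {a..b})"
      by blast
    have min: "b \<le> b'" if "(a', b', k') \<in> C" "k' < card (V \<inter> {a'..b'})" for a' b' k'
      unfolding b_def using that by (intro Least_le) blast
    define v where "v = Max (V \<inter> {a..b})"
    have "V \<inter> {a..b} \<noteq> {}"
      using C(2) by auto
    then have "v \<in> V \<inter> {a..b}"
      unfolding v_def by (intro Max_in) auto
    then have v: "v \<in> V" by simp
    show ?thesis
    proof (cases "{v} \<in> interval_bounded V C")
      case False
      then show ?thesis
        using IH[OF v, of C] interval_bounded_remove_nonvertex by simp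
    next
      case vertex: True
      show ?thesis
      proof (rule vertex_decomposable.shedding[where v = v])
        show "simplicial_complex_on V (interval_bounded V C)"
          using less.prems by (rule simplicial_complex_on_interval_bounded)
        show "vertex_decomposable (deletion (interval_bounded V C) v)"
          unfolding deletion_interval_bounded using v by (rule IH)
        show "vertex_decomposable (link (interval_bounded V C) v)"
          unfolding link_interval_bounded[OF vertex] using v by (rule IH)
        show "facets (deletion (interval_bounded V C) v) \<subseteq> facets (interval_bounded V C)"
          unfolding v_def using less.prems C min by (rule interval_bounded_shedding)
      qed (rule vertex)
    qed
  qed
qed

text \<open>By the clique condition any \<open>card F\<close> elements of \<open>A\<close> in the
  interval of a facet \<open>F\<close> form a facet, and \<open>F\<close> lies in its own interval.
  Avoiding facets thus becomes a matter of counting.\<close>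

lemma Ind_eq_interval_bounded:
  assumes "interval_complex n \<Delta>"
  shows "Ind n \<Delta> = interval_bounded {1..n} ((\<lambda>F. (Min F, Max F, card F - 1)) ` facets \<Delta>)"
proof -
  have "(\<exists>F\<in>facets \<Delta>. F \<subseteq> A) \<longleftrightarrow>
      (\<exists>F\<in>facets \<Delta>. \<not> card (A \<inter> {Min F..Max F}) \<le> card F - 1)" for A
  proof safe
    fix F assume F: "F \<in> facets \<Delta>" "F \<subseteq> A"
    \<comment> \<open>Nonemptiness makes \<open>card F - 1\<close> strictly smaller than
      \<open>card F\<close>, so that containing \<open>F\<close> violates the bound.\<close>
    have "F \<noteq> {}"
      using assms F(1) unfolding interval_complex_def by blast
    moreover have "F \<subseteq> {1..n}"
      using assms F(1)
      unfolding interval_complex_def simplicial_complex_on_def facets_def by blast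
    then have "finite F"
      by (rule finite_subset) simp
    ultimately have "F \<subseteq> A \<inter> {Min F..Max F}" "card F > 0"
      using F(2) by (auto simp: card_gt_0_iff)
    moreover from this(1) have "card F \<le> card (A \<inter> {Min F..Max F})"
      by (intro card_mono) simp
    ultimately show "\<exists>F\<in>facets \<Delta>. \<not> card (A \<inter> {Min F..Max F}) \<le> card F - 1"
      using F(1) by (intro bexI[of _ F]) auto
  next
    fix F assume F: "F \<in> facets \<Delta>" "\<not> card (A \<inter> {Min F..Max F}) \<le> card F - 1"
    then have "card F \<le> card (A \<inter> {Min F..Max F})" by simp
    then obtain G where G: "G \<subseteq> A \<inter> {Min F..Max F}" "card G = card F"
      by (meson obtain_subset_with_card_n)
    then have "G \<in> facets \<Delta>"
      using assms F(1) unfolding interval_complex_def by simp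
    then show "\<exists>F\<in>facets \<Delta>. F \<subseteq> A"
      using G(1) by blast
  qed
  then show ?thesis
    unfolding Ind_def interval_bounded_def by auto
qed

theorem theorem4p1:
  fixes n :: nat and \<Delta> :: "nat set set"
  assumes "interval_complex n \<Delta>"
  shows "vertex_decomposable (Ind n \<Delta>)"
  unfolding Ind_eq_interval_bounded[OF assms]
  by (rule vertex_decomposable_interval_bounded) simp

end
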